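(* Let $W$ be the Weyl group of a Cartan matrix of finite type with index set $I$, and let $c$ be a Coxeter element of $W$. For every $i\in I$, there is a positive integer $h(i;c)$ such that $$\omega_i>c\,\omega_i>c^2\omega_i>\cdots>c^{h(i;c)}\omega_i=-\omega_{i^\star}.$$
   Context: $A=(a_{i,j})_{i,j\in I}$ is a Cartan matrix of finite type with simple roots $\alpha_i$, fundamental weights $\omega_i$ ($\alpha_j=\sum_i a_{i,j}\omega_i$), and Weyl group $W$ generated by the simple reflections $s_i$, $s_i\alpha_j=\alpha_j-a_{i,j}\alpha_i$. A Coxeter element is a product of all simple reflections, each once, in some order. Weights are partially ordered by $\gamma\ge\delta$ iff $\gamma-\delta$ is a nonnegative integer linear combination of simple roots. The involution $i\mapsto i^\star$ of $I$ is defined by $\omega_{i^\star}=-w_\circ(\omega_i)$, where $w_\circ$ is the longest element of $W$. *)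

theory Defs
  imports "HOL-Analysis.Analysis" "HOL-Algebra.Bij" "HOL-Algebra.Generated_Groups"
begin

text \<open>
  The index set is a finite type \<open>'i\<close>; the entry \<open>a\<^sub>i\<^sub>j\<close> of the matrix is \<open>A $ i $ j\<close>.
  The finite type condition is that \<open>A\<close> is symmetrizable with positive definite symmetrization.
\<close>

definition cartan_matrix :: "int ^ 'i ^ 'i \<Rightarrow> bool" where
  "cartan_matrix A \<longleftrightarrow>
     (\<forall>i. A $ i $ i = 2) \<and>
     (\<forall>i j. i \<noteq> j \<longrightarrow> A $ i $ j \<le> 0) \<and>
     (\<forall>i j. A $ i $ j = 0 \<longleftrightarrow> A $ j $ i = 0)"

definition finite_type_cartan_matrix :: "int ^ 'i ^ 'i \<Rightarrow> bool" where
  "finite_type_cartan_matrix A \<longleftrightarrow>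
     cartan_matrix A \<and>
     (\<exists>d :: 'i::finite \<Rightarrow> real.
        (\<forall>i. d i > 0) \<and>
        (\<forall>i j. d i * real_of_int (A $ i $ j) = d j * real_of_int (A $ j $ i)) \<and>
        (\<forall>x :: real ^ 'i. x \<noteq> 0 \<longrightarrow>
           (\<Sum>i\<in>UNIV. \<Sum>j\<in>UNIV. d i * real_of_int (A $ i $ j) * x $ i * x $ j) > 0))"

text \<open>
  Weights are vectors of \<open>real ^ 'i\<close>, written in coordinates with respect to the basis of
  fundamental weights: \<open>\<lambda> $ i\<close> is the coefficient of \<open>\<omega>\<^sub>i\<close>, i.e. the pairing of \<open>\<lambda>\<close> with the
  \<open>i\<close>-th simple coroot. In particular the componentwise order that the library puts on
  \<open>real ^ 'i\<close> is not the order on weights considered here.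
\<close>

definition fundamental_weight :: "'i \<Rightarrow> real ^ 'i" where
  "fundamental_weight i = axis i 1"

definition simple_root :: "int ^ 'i ^ 'i \<Rightarrow> 'i \<Rightarrow> real ^ 'i" where
  "simple_root A j = (\<Sum>i\<in>UNIV. real_of_int (A $ i $ j) *\<^sub>R fundamental_weight i)"

definition simple_reflection :: "int ^ 'i ^ 'i \<Rightarrow> 'i \<Rightarrow> real ^ 'i \<Rightarrow> real ^ 'i" where
  "simple_reflection A i v = v - (v $ i) *\<^sub>R simple_root A i"

definition weight_ge :: "int ^ 'i ^ 'i \<Rightarrow> real ^ 'i \<Rightarrow> real ^ 'i \<Rightarrow> bool" where
  "weight_ge A \<gamma> \<delta> \<longleftrightarrow>
     (\<exists>n :: 'i \<Rightarrow> nat. \<gamma> - \<delta> = (\<Sum>i\<in>UNIV. real (n i) *\<^sub>R simple_root A i))"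

definition weight_gt :: "int ^ 'i ^ 'i \<Rightarrow> real ^ 'i \<Rightarrow> real ^ 'i \<Rightarrow> bool" where
  "weight_gt A \<gamma> \<delta> \<longleftrightarrow> weight_ge A \<gamma> \<delta> \<and> \<gamma> \<noteq> \<delta>"

definition weyl_group :: "int ^ 'i ^ 'i \<Rightarrow> (real ^ 'i \<Rightarrow> real ^ 'i) set" where
  "weyl_group A = generate (BijGroup UNIV) (range (simple_reflection A))"

definition reflection_product :: "int ^ 'i ^ 'i \<Rightarrow> 'i list \<Rightarrow> real ^ 'i \<Rightarrow> real ^ 'i" where
  "reflection_product A is = foldr (\<circ>) (map (simple_reflection A) is) id"

definition weyl_length :: "int ^ 'i ^ 'i \<Rightarrow> (real ^ 'i \<Rightarrow> real ^ 'i) \<Rightarrow> nat" where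
  "weyl_length A w = (LEAST n. \<exists>is. length is = n \<and> w = reflection_product A is)"

definition longest_element :: "int ^ 'i ^ 'i \<Rightarrow> real ^ 'i \<Rightarrow> real ^ 'i" where
  "longest_element A =
     (THE w. w \<in> weyl_group A \<and> (\<forall>v\<in>weyl_group A. weyl_length A v \<le> weyl_length A w))"

definition star_involution :: "int ^ 'i ^ 'i \<Rightarrow> 'i \<Rightarrow> 'i" where
  "star_involution A i =
     (THE j. fundamental_weight j = - longest_element A (fundamental_weight i))"

definition coxeter_element :: "int ^ 'i ^ 'i \<Rightarrow> (real ^ 'i \<Rightarrow> real ^ 'i) \<Rightarrow> bool" where
  "coxeter_element A c \<longleftrightarrow>
     (\<exists>is. distinct is \<and> set is = UNIV \<and> c = reflection_product A is)"

lemma simple_root_nth: "simple_root A j $ i = real_of_int (A $ i $ j)"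
  by (simp add: simple_root_def fundamental_weight_def axis_def if_distrib[of "\<lambda>x. _ * x"]
      cong: if_cong)

lemma simple_reflection_simple_root:
  "simple_reflection A i (simple_root A j)
     = simple_root A j - real_of_int (A $ i $ j) *\<^sub>R simple_root A i"
  by (simp add: simple_reflection_def simple_root_nth)

lemma linear_simple_reflection: "linear (simple_reflection A i)"
  by (rule linearI) (simp_all add: simple_reflection_def algebra_simps)

lemma independent_simple_roots:
  assumes "finite_type_cartan_matrix A"
    and "(\<Sum>j\<in>UNIV. x $ j *\<^sub>R simple_root A j) = 0"
  shows "x = 0"
proof (rule ccontr)
  assume "x \<noteq> 0"
  obtain d :: "'a \<Rightarrow> real" where
    pos: "(\<Sum>i\<in>UNIV. \<Sum>j\<in>UNIV. d i * real_of_int (A $ i $ j) * x $ i * x $ j) > 0"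
    using assms(1) \<open>x \<noteq> 0\<close> unfolding finite_type_cartan_matrix_def by blast
  have "(\<Sum>j\<in>UNIV. x $ j * real_of_int (A $ i $ j)) = 0" for i
    using arg_cong[OF assms(2), of "\<lambda>v. v $ i"] by (simp add: simple_root_nth)
  then have "(\<Sum>i\<in>UNIV. d i * x $ i * (\<Sum>j\<in>UNIV. x $ j * real_of_int (A $ i $ j))) = 0"
    by simp
  with pos show False
    by (simp add: sum_distrib_left mult_ac)
qed

text \<open>
  On a matrix of finite type, \<open>simple_reflection A i\<close> is the only linear map with the prescribed
  values on the simple roots.
\<close>

lemma simple_reflection_unique:
  assumes A: "finite_type_cartan_matrix A" and f: "linear f"
    and eq: "\<And>j. f (simple_root A j) = simple_root A j - real_of_int (A $ i $ j) *\<^sub>R simple_root A i"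
  shows "f = simple_reflection A i"
proof
  fix v
  define g where "g x = (\<Sum>j\<in>UNIV. x $ j *\<^sub>R simple_root A j)" for x :: "real ^ 'a"
  have g: "linear g"
    by (rule linearI) (simp_all add: g_def scaleR_add_left sum.distrib scaleR_sum_right)
  have "inj g"
    unfolding linear_injective_0[OF g] using independent_simple_roots[OF A] by (simp add: g_def)
  then obtain x where "v = g x"
    using linear_injective_imp_surjective[OF g] by (metis surjD)
  then show "f v = simple_reflection A i v"
    by (simp add: g_def linear_sum[OF f] linear_cmul[OF f] linear_sum[OF linear_simple_reflection]
        linear_cmul[OF linear_simple_reflection] eq simple_reflection_simple_root)
qed

lemma simple_reflection_involutive:
  assumes "cartan_matrix A"
  shows "simple_reflection A i (simple_reflection A i v) = v"
proof -
  have "simple_root A i $ i = 2"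
    using assms by (simp add: simple_root_nth cartan_matrix_def)
  then show ?thesis
    by (simp add: simple_reflection_def algebra_simps flip: scaleR_add_left)
qed

text \<open>The words in the simple reflections, over which \<open>weyl_length\<close> is minimised, exhaust the
  Weyl group.\<close>

lemma weyl_group_eq_range:
  assumes "cartan_matrix A"
  shows "weyl_group A = range (reflection_product A)"
proof -
  let ?G = "BijGroup (UNIV :: (real ^ 'a) set)"
  have inv: "simple_reflection A i \<circ> simple_reflection A i = id" for i
    using simple_reflection_involutive[OF assms] by auto
  have s_Bij: "simple_reflection A i \<in> carrier ?G" for i
    using o_bij[OF inv inv] by (simp add: BijGroup_def Bij_def bij_def)
  have mult: "f \<otimes>\<^bsub>?G\<^esub> g = f \<circ> g" if "f \<in> carrier ?G" "g \<in> carrier ?G" for f g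
    using that by (auto simp: BijGroup_def compose_def)
  have one: "\<one>\<^bsub>?G\<^esub> = id"
    by (auto simp: BijGroup_def)
  interpret group ?G by (rule group_BijGroup)
  have s_inv: "inv\<^bsub>?G\<^esub> (simple_reflection A i) = simple_reflection A i" for i
    by (rule inv_equality) (simp_all add: mult one inv s_Bij)
  have sub: "weyl_group A \<subseteq> carrier ?G"
    unfolding weyl_group_def by (rule generate_incl) (use s_Bij in auto)
  have app: "reflection_product A (us @ vs) = reflection_product A us \<circ> reflection_product A vs"
    for us vs
    by (induction us) (simp_all add: reflection_product_def comp_assoc)
  have "w \<in> range (reflection_product A)" if "w \<in> weyl_group A" for w
    using that unfolding weyl_group_def
  proof (induction rule: generate.induct)
    case one
    show ?case by (rule range_eqI[of _ _ "[]"]) (simp add: \<open>\<one>\<^bsub>?G\<^esub> = id\<close> reflection_product_def)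
  next
    case (incl h)
    then obtain i where "h = simple_reflection A i" by auto
    then show ?case by (intro range_eqI[of _ _ "[i]"]) (simp add: reflection_product_def)
  next
    case (inv h)
    then obtain i where "h = simple_reflection A i" by auto
    then show ?case by (intro range_eqI[of _ _ "[i]"]) (simp add: s_inv reflection_product_def)
  next
    case (eng h1 h2)
    then have "h1 \<otimes>\<^bsub>?G\<^esub> h2 = h1 \<circ> h2"
      using sub by (intro mult) (auto simp: weyl_group_def)
    moreover obtain us vs where "h1 = reflection_product A us" "h2 = reflection_product A vs"
      using eng.IH by blast
    ultimately have "h1 \<otimes>\<^bsub>?G\<^esub> h2 = reflection_product A (us @ vs)"
      by (simp only: app)
    then show ?case by (rule range_eqI)
  qed
  moreover have "reflection_product A us \<in> weyl_group A" for us
  proof (induction us)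
    case Nil
    have "reflection_product A [] = \<one>\<^bsub>?G\<^esub>"
      unfolding one by (simp add: reflection_product_def)
    then show ?case
      unfolding weyl_group_def by (simp only: generate.one)
  next
    case (Cons i us)
    have "simple_reflection A i \<otimes>\<^bsub>?G\<^esub> reflection_product A us \<in> weyl_group A"
      using Cons unfolding weyl_group_def by (intro generate.eng[OF generate.incl]) auto
    moreover have "simple_reflection A i \<otimes>\<^bsub>?G\<^esub> reflection_product A us
        = reflection_product A (i # us)"
      using mult[OF s_Bij subsetD[OF sub Cons]] by (simp add: reflection_product_def)
    ultimately show ?case by simp
  qed
  ultimately show ?thesis by auto
qed

end

(*
  Write \<omega>_j - c \<omega>_j = \<beta>_j, a positive root, so that c^k \<omega>_j - c^(k+1) \<omega>_j = c^k \<beta>_j. These roots cannot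
  all be positive because c has finite order; let h be the first exponent with c^h \<beta>_j negative.
  Then c^(h-1) \<beta>_j is a positive root made negative by c, which forces c^h \<beta>_j = - \<beta>_i for some i.
  As 1 - c is injective, c^h \<omega>_j = - \<omega>_i. This weight and w_0 \<omega>_j are both antidominant and lie in
  one W-orbit, so they agree and i is the star of j.
*)

theory Submission
  imports Defs
begin

section \<open>Parity of symmetric sums and bounded sets of lattice vectors\<close>

text \<open>Off-diagonal terms come in equal pairs. This gives the evenness behind the lower bound
  \<open>form_integral_ge\<close>.\<close>

lemma even_sum_symmetric:
  fixes f :: "'a \<Rightarrow> 'a \<Rightarrow> int"
  assumes "finite S" and sym: "\<And>i j. f i j = f j i" and diag: "\<And>i. even (f i i)"
  shows "even (\<Sum>i\<in>S. \<Sum>j\<in>S. f i j)"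
  using assms(1)
proof (induction S)
  case (insert a S)
  have "(\<Sum>i\<in>S. f i a) = (\<Sum>j\<in>S. f a j)"
    using sym by (rule sum.cong[OF refl])
  then have "(\<Sum>i\<in>insert a S. \<Sum>j\<in>insert a S. f i j)
      = f a a + 2 * (\<Sum>j\<in>S. f a j) + (\<Sum>i\<in>S. \<Sum>j\<in>S. f i j)"
    using insert.hyps by (simp add: sum.distrib)
  then show ?case
    using insert.IH diag by simp
qed simp

lemma finite_integral_vectors:
  fixes C :: real
  shows "finite {x :: real ^ 'i::finite. (\<forall>j. x $ j \<in> \<int>) \<and> norm x \<le> C}"
proof (rule finite_subset)
  let ?S = "{t \<in> \<int>. - C \<le> t \<and> t \<le> C}"
  let ?P = "PiE (UNIV :: 'i set) (\<lambda>_. ?S)"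
  show "finite (vec_lambda ` ?P)"
    by (intro finite_imageI finite_PiE finite_int_segment) simp
  show "{x :: real ^ 'i. (\<forall>j. x $ j \<in> \<int>) \<and> norm x \<le> C} \<subseteq> vec_lambda ` ?P"
  proof
    fix x :: "real ^ 'i"
    assume x: "x \<in> {x. (\<forall>j. x $ j \<in> \<int>) \<and> norm x \<le> C}"
    then have "\<bar>x $ j\<bar> \<le> C" for j
      using order_trans[OF component_le_norm_cart] by blast
    then have "vec_nth x \<in> ?P"
      using x by (auto simp: abs_le_iff minus_le_iff)
    then show "x \<in> vec_lambda ` ?P"
      by (rule image_eqI[rotated]) (simp add: vec_nth_inverse)
  qed
qed

section \<open>Words in the simple reflections\<close>

lemma reflection_product_Nil [simp]: "reflection_product A [] = id"
  by (simp add: reflection_product_def)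

lemma reflection_product_Cons [simp]:
  "reflection_product A (i # us) = simple_reflection A i \<circ> reflection_product A us"
  by (simp add: reflection_product_def)

lemma reflection_product_append [simp]:
  "reflection_product A (us @ vs) = reflection_product A us \<circ> reflection_product A vs"
  by (induction us) (simp_all add: comp_assoc)

lemma linear_reflection_product: "linear (reflection_product A us)"
proof (induction us)
  case (Cons i us)
  then show ?case
    unfolding reflection_product_Cons by (intro linear_compose linear_simple_reflection)
qed (auto intro: linearI)

lemma simple_reflection_fundamental_weight:
  "simple_reflection A k (fundamental_weight j)
     = fundamental_weight j - (if k = j then simple_root A k else 0)"
  by (simp add: simple_reflection_def fundamental_weight_def axis_def)

lemma reflection_product_fundamental_weight:
  "j \<notin> set us \<Longrightarrow> reflection_product A us (fundamental_weight j) = fundamental_weight j"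
  by (induction us) (auto simp: simple_reflection_fundamental_weight)

lemma weyl_length_le: "weyl_length A (reflection_product A us) \<le> length us"
  unfolding weyl_length_def by (rule Least_le) blast

lemma weyl_length_word:
  obtains us where "reflection_product A vs = reflection_product A us"
    and "length us = weyl_length A (reflection_product A vs)"
proof -
  have "\<exists>n us. length us = n \<and> reflection_product A vs = reflection_product A us" by blast
  then have "\<exists>us. length us = weyl_length A (reflection_product A vs)
      \<and> reflection_product A vs = reflection_product A us"
    unfolding weyl_length_def by (rule LeastI_ex)
  then show thesis using that by blast
qed

section \<open>Simple-root coordinates and the invariant form\<close>

text \<open>One symmetrizer \<open>d\<close> is fixed, since the form and the notion of root below
  depend on it.\<close>

locale symmetrized_cartan_matrix =
  fixes A :: "int ^ 'i::finite ^ 'i" and d :: "'i \<Rightarrow> real"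
  assumes cartan: "cartan_matrix A"
    and d_pos: "d i > 0"
    and symmetrized: "d i * real_of_int (A $ i $ j) = d j * real_of_int (A $ j $ i)"
    and pos_def: "x \<noteq> 0 \<Longrightarrow>
      (\<Sum>i\<in>UNIV. \<Sum>j\<in>UNIV. d i * real_of_int (A $ i $ j) * x $ i * x $ j) > 0"
begin

abbreviation "\<alpha> \<equiv> simple_root A"
abbreviation "s \<equiv> simple_reflection A"
abbreviation "prd \<equiv> reflection_product A"

definition root_combination :: "real ^ 'i \<Rightarrow> real ^ 'i" where
  "root_combination x = (\<Sum>j\<in>UNIV. x $ j *\<^sub>R \<alpha> j)"

definition coord :: "real ^ 'i \<Rightarrow> real ^ 'i" where
  "coord = inv_into UNIV root_combination"

text \<open>The \<open>W\<close>-invariant form with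
  \<open>form (\<alpha> j) (\<alpha> k) = d j * A $ j $ k\<close>. The left argument is read in
  fundamental-weight coordinates and the right one in simple-root coordinates, so a dominant
  \<open>u\<close> and a positive root \<open>v\<close> visibly give a nonnegative value.\<close>

definition form :: "real ^ 'i \<Rightarrow> real ^ 'i \<Rightarrow> real" where
  "form u v = (\<Sum>j\<in>UNIV. d j * u $ j * coord v $ j)"

lemma finite_type: "finite_type_cartan_matrix A"
  unfolding finite_type_cartan_matrix_def using cartan d_pos symmetrized pos_def by blast

lemma linear_root_combination: "linear root_combination"
  by (rule linearI)
    (simp_all add: root_combination_def scaleR_add_left sum.distrib scaleR_sum_right)

lemma bij_root_combination: "bij root_combination"
proof -
  have "inj root_combination"
    unfolding linear_injective_0[OF linear_root_combination]
    using independent_simple_roots[OF finite_type] by (simp add: root_combination_def)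
  then show ?thesis
    using linear_injective_imp_surjective[OF linear_root_combination] by (simp add: bij_def)
qed

lemma coord_root_combination [simp]: "coord (root_combination x) = x"
  by (simp add: coord_def bij_is_inj[OF bij_root_combination])

lemma root_combination_coord [simp]: "root_combination (coord v) = v"
  by (simp add: coord_def bij_is_surj[OF bij_root_combination] surj_f_inv_f)

lemma coord_eq_iff: "coord u = coord v \<longleftrightarrow> u = v"
  by (metis root_combination_coord)

lemma linear_coord: "linear coord"
proof (rule linearI)
  show "coord (u + v) = coord u + coord v" for u v
    by (metis coord_root_combination linear_add[OF linear_root_combination] root_combination_coord)
  show "coord (r *\<^sub>R v) = r *\<^sub>R coord v" for r v
    by (metis coord_root_combination linear_cmul[OF linear_root_combination] root_combination_coord)
qed

lemmas coord_diff [simp] = linear_diff[OF linear_coord]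
  and coord_minus [simp] = linear_neg[OF linear_coord]
  and coord_scaleR [simp] = linear_cmul[OF linear_coord]
  and coord_zero [simp] = linear_0[OF linear_coord]

lemma root_combination_axis: "root_combination (axis j 1) = \<alpha> j"
  by (simp add: root_combination_def axis_def if_distrib[of "\<lambda>x. x *\<^sub>R _"] cong: if_cong)

lemma coord_simple_root [simp]: "coord (\<alpha> j) = axis j 1"
  by (metis coord_root_combination root_combination_axis)

lemma nth_eq_coord: "v $ k = (\<Sum>j\<in>UNIV. real_of_int (A $ k $ j) * coord v $ j)"
proof -
  have "v $ k = root_combination (coord v) $ k" by simp
  also have "\<dots> = (\<Sum>j\<in>UNIV. real_of_int (A $ k $ j) * coord v $ j)"
    unfolding root_combination_def by (simp add: simple_root_nth mult.commute)
  finally show ?thesis .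
qed

lemma coord_simple_reflection:
  "coord (s k v) $ j = coord v $ j - (if j = k then v $ k else 0)"
  by (simp add: simple_reflection_def axis_def)

lemma form_diff_left: "form (u - u') v = form u v - form u' v"
  by (simp add: form_def algebra_simps sum_subtractf)

lemma form_minus_right: "form u (- v) = - form u v"
  by (simp add: form_def sum_negf)

lemma form_diff_right: "form u (v - v') = form u v - form u v'"
  by (simp add: form_def algebra_simps sum_subtractf)

lemma form_scaleR_left: "form (r *\<^sub>R u) v = r * form u v"
  by (simp add: form_def sum_distrib_left mult_ac)

lemma form_scaleR_right: "form u (r *\<^sub>R v) = r * form u v"
  by (simp add: form_def sum_distrib_left mult_ac)

lemma form_eq:
  "form u v = (\<Sum>j\<in>UNIV. \<Sum>k\<in>UNIV. d j * real_of_int (A $ j $ k) * coord v $ j * coord u $ k)"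
  unfolding form_def nth_eq_coord[of u] by (simp add: sum_distrib_left sum_distrib_right mult_ac)

lemma form_pos: "v \<noteq> 0 \<Longrightarrow> form v v > 0"
  unfolding form_eq by (rule pos_def) (metis coord_eq_iff coord_zero)

lemma form_simple_root_right: "form u (\<alpha> k) = d k * u $ k"
  by (simp add: form_def axis_def if_distrib[of "\<lambda>x. _ * x"] cong: if_cong)

lemma form_simple_root_left: "form (\<alpha> k) v = d k * v $ k"
proof -
  have "form (\<alpha> k) v = (\<Sum>j\<in>UNIV. d j * real_of_int (A $ j $ k) * coord v $ j)"
    by (simp add: form_def simple_root_nth)
  also have "\<dots> = d k * v $ k"
    unfolding nth_eq_coord[of v] sum_distrib_left
    by (intro sum.cong refl) (simp add: symmetrized[of _ k])
  finally show ?thesis .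
qed

lemma simple_root_diag: "\<alpha> k $ k = 2"
  using cartan by (simp add: simple_root_nth cartan_matrix_def)

lemma reflection_reflection [simp]: "s k (s k v) = v"
  by (rule simple_reflection_involutive[OF cartan])

lemma reflection_simple_root_self: "s k (\<alpha> k) = - \<alpha> k"
  by (simp add: simple_reflection_def simple_root_diag scaleR_2)

text \<open>\<open>s k\<close> is self-adjoint for the form and an involution, hence an
  isometry.\<close>

lemma form_simple_reflection: "form (s k u) (s k v) = form u v"
proof -
  have "form (s k u) v = form u (s k v)" for u v
    by (simp add: simple_reflection_def form_diff_left form_diff_right form_scaleR_left
        form_scaleR_right form_simple_root_left form_simple_root_right)
  then show ?thesis by simp
qed

lemma form_reflection_product: "form (prd us u) (prd us v) = form u v"
  by (induction us) (simp_all add: form_simple_reflection)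

section \<open>Roots as lattice vectors, and their signs\<close>

text \<open>
  Instead of the orbit of the simple roots, we use the lattice vectors whose norm is that of a
  simple root and whose dual is integral too. This set is visibly finite and stable under \<open>W\<close>.
\<close>

definition is_root :: "real ^ 'i \<Rightarrow> bool" where
  "is_root v \<longleftrightarrow> (\<exists>i. form v v = 2 * d i \<and>
     (\<forall>j. coord v $ j \<in> \<int> \<and> d j * coord v $ j / d i \<in> \<int>))"

definition pos_root :: "real ^ 'i \<Rightarrow> bool" where
  "pos_root v \<longleftrightarrow> is_root v \<and> (\<forall>j. coord v $ j \<ge> 0)"

lemma is_root_simple_root: "is_root (\<alpha> i)"
  unfolding is_root_def
  by (rule exI[of _ i])
    (auto simp: form_simple_root_right simple_root_diag axis_def d_pos less_imp_neq[symmetric])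

lemma pos_root_simple_root: "pos_root (\<alpha> i)"
  by (simp add: pos_root_def is_root_simple_root axis_def)

lemma is_root_minus: "is_root v \<Longrightarrow> is_root (- v)"
  unfolding is_root_def by (auto simp: form_def)

text \<open>Only the coordinate at \<open>k\<close> changes, by \<open>v $ k\<close>, so it suffices
  that \<open>v $ k\<close> and \<open>d k * v $ k / d i\<close> are integers.\<close>

lemma is_root_simple_reflection:
  assumes "is_root v"
  shows "is_root (s k v)"
proof -
  obtain i where i: "form v v = 2 * d i"
    and x: "\<And>j. coord v $ j \<in> \<int>" "\<And>j. d j * coord v $ j / d i \<in> \<int>"
    using assms unfolding is_root_def by blast
  have 1: "v $ k \<in> \<int>"
    unfolding nth_eq_coord[of v] by (intro Ints_sum Ints_mult x) simp
  \<comment> \<open>The symmetrizer turns \<open>d k * A $ k $ j\<close> into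
    \<open>d j * A $ j $ k\<close>, so the dual coordinates appear with integer
    coefficients.\<close>
  have "d k * v $ k / d i = (\<Sum>j\<in>UNIV. real_of_int (A $ j $ k) * (d j * coord v $ j / d i))"
    unfolding nth_eq_coord[of v] sum_distrib_left sum_divide_distrib mult.assoc[symmetric]
      symmetrized[of k]
    by (intro sum.cong refl) simp
  also have "\<dots> \<in> \<int>"
    by (intro Ints_sum Ints_mult x) simp
  finally have 2: "d k * v $ k / d i \<in> \<int>" .
  have "coord (s k v) $ j \<in> \<int> \<and> d j * coord (s k v) $ j / d i \<in> \<int>" for j
    using x[of j] 1 2
    by (auto simp: coord_simple_reflection right_diff_distrib diff_divide_distrib)
  then show ?thesis
    unfolding is_root_def using i form_simple_reflection by auto
qed

lemma is_root_reflection_product: "is_root v \<Longrightarrow> is_root (prd us v)"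
  by (induction us) (simp_all add: is_root_simple_reflection)

lemma is_root_nonzero: "is_root v \<Longrightarrow> v \<noteq> 0"
  by (auto simp: is_root_def form_def d_pos less_imp_neq)

text \<open>The form, divided by \<open>d i\<close>, is an even integral form on the vectors below.\<close>

lemma form_integral_ge:
  assumes "v \<noteq> 0" and x: "\<And>j. coord v $ j \<in> \<int>" "\<And>j. d j * coord v $ j / d i \<in> \<int>"
  shows "form v v \<ge> 2 * d i"
proof -
  have "\<forall>j. \<exists>a. coord v $ j = real_of_int a"
    using x(1) by (auto simp: Ints_def)
  then obtain n where n: "\<And>j. coord v $ j = real_of_int (n j)"
    by metis
  have "\<forall>j. \<exists>a. d j * coord v $ j / d i = real_of_int a"
    using x(2) by (auto simp: Ints_def)
  then obtain m where "\<And>j. d j * coord v $ j / d i = real_of_int (m j)"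
    by metis
  then have m: "d j * coord v $ j = d i * real_of_int (m j)" for j
    using d_pos[of i] by (simp add: field_simps)
  \<comment> \<open>This is the term of \<open>form v v\<close> at \<open>j\<close>,
    \<open>k\<close> divided by \<open>d i\<close>, written with integers only. It is symmetric by
    the symmetrizer, and even for \<open>j = k\<close> because \<open>A $ j $ j = 2\<close>.\<close>
  let ?f = "\<lambda>j k. m j * A $ j $ k * n k"
  have f: "d i * real_of_int (?f j k) = d j * real_of_int (A $ j $ k) * coord v $ j * coord v $ k"
    for j k
  proof -
    have "d i * real_of_int (?f j k) = (d i * real_of_int (m j)) * real_of_int (A $ j $ k) * n k"
      by simp
    then show ?thesis
      unfolding m[symmetric] n[symmetric] by simp
  qed
  have "?f j k = ?f k j" for j k
  proof -
    have "d i * real_of_int (?f j k) = d i * real_of_int (?f k j)"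
      unfolding f using symmetrized[of j k] by simp
    then have "real_of_int (?f j k) = real_of_int (?f k j)"
      using d_pos[of i] by (simp del: of_int_mult)
    then show ?thesis by (simp only: of_int_eq_iff)
  qed
  then have "even (\<Sum>j\<in>UNIV. \<Sum>k\<in>UNIV. ?f j k)"
    using cartan by (intro even_sum_symmetric) (auto simp: cartan_matrix_def)
  moreover have form: "form v v = d i * real_of_int (\<Sum>j\<in>UNIV. \<Sum>k\<in>UNIV. ?f j k)"
    unfolding form_eq f[symmetric] by (simp add: sum_distrib_left)
  then have "(\<Sum>j\<in>UNIV. \<Sum>k\<in>UNIV. ?f j k) > 0"
    using form_pos[OF assms(1)] d_pos[of i]
    by (simp only: zero_less_mult_iff of_int_0_less_iff) linarith
  ultimately have "(\<Sum>j\<in>UNIV. \<Sum>k\<in>UNIV. ?f j k) \<ge> 2"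
    by presburger
  then have "2 \<le> real_of_int (\<Sum>j\<in>UNIV. \<Sum>k\<in>UNIV. ?f j k)"
    by linarith
  then show ?thesis
    unfolding form using d_pos[of i] by (simp add: mult.commute mult_left_mono)
qed

text \<open>
  If the positive part \<open>p\<close> and the negative part \<open>q\<close> of a root were both nonzero, then its norm
  would be at least \<open>form p p + form q q \<ge> 4 * d i\<close>, because \<open>p\<close> and \<open>q\<close> have disjoint supports.
\<close>

lemma root_dichotomy:
  assumes "is_root v"
  shows "pos_root v \<or> pos_root (- v)"
proof (rule ccontr)
  assume neg: "\<not> ?thesis"
  obtain i where i: "form v v = 2 * d i"
    and x: "\<And>j. coord v $ j \<in> \<int>" "\<And>j. d j * coord v $ j / d i \<in> \<int>"
    using assms unfolding is_root_def by blast
  define p where "p = root_combination (\<chi> j. max (coord v $ j) 0)"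
  define q where "q = root_combination (\<chi> j. max (- coord v $ j) 0)"
  have p: "coord p $ j = max (coord v $ j) 0" and q: "coord q $ j = max (- coord v $ j) 0" for j
    by (simp_all add: p_def q_def)
  have "coord v = coord (p - q)"
    by (simp add: vec_eq_iff p q max_def)
  then have v: "v = p - q"
    by (simp only: coord_eq_iff)
  obtain j k where "coord v $ j < 0" "coord v $ k > 0"
    using neg assms is_root_minus[OF assms] unfolding pos_root_def by (auto simp: not_le)
  then have "coord p $ k \<noteq> 0" "coord q $ j \<noteq> 0"
    by (simp_all add: p q)
  then have "p \<noteq> 0" "q \<noteq> 0"
    by auto
  have "form p p \<ge> 2 * d i"
    using x by (intro form_integral_ge \<open>p \<noteq> 0\<close>) (auto simp: p max_def)
  moreover have "form q q \<ge> 2 * d i"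
    using x by (intro form_integral_ge \<open>q \<noteq> 0\<close>) (auto simp: q max_def)
  moreover have cross: "form u w \<le> 0"
    if "\<And>j. coord u $ j \<ge> 0" "\<And>j. coord w $ j \<ge> 0" "\<And>j. coord u $ j * coord w $ j = 0" for u w
    unfolding form_eq
  proof (intro sum_nonpos)
    fix j k
    \<comment> \<open>Disjoint supports kill the diagonal terms; elsewhere the entries of
      \<open>A\<close> are nonpositive.\<close>
    show "d j * real_of_int (A $ j $ k) * coord w $ j * coord u $ k \<le> 0"
    proof (cases "j = k")
      case True
      then show ?thesis using that(3)[of k] by (auto simp: mult_ac)
    next
      case False
      then have "real_of_int (A $ j $ k) \<le> 0"
        using cartan by (simp add: cartan_matrix_def)
      then show ?thesis
        using d_pos[of j] that by (intro mult_nonpos_nonneg mult_nonneg_nonpos) auto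
    qed
  qed
  then have "form p q \<le> 0" "form q p \<le> 0"
    by (intro cross; simp add: p q max_def)+
  moreover have "form v v = form p p - form p q - form q p + form q q"
    by (simp add: v form_diff_left form_diff_right)
  ultimately show False
    using i d_pos[of i] by linarith
qed

lemma not_pos_root_minus: "pos_root v \<Longrightarrow> \<not> pos_root (- v)"
proof
  assume "pos_root v" "pos_root (- v)"
  then have "coord v $ j = 0" for j
    by (auto simp: pos_root_def intro: order_antisym)
  then have "coord v = coord 0"
    by (simp add: vec_eq_iff)
  then show False
    using is_root_nonzero \<open>pos_root v\<close> unfolding coord_eq_iff pos_root_def by blast
qed

text \<open>By the dichotomy a root has no coordinates of opposite signs, so one positive coordinate
  decides.\<close>

lemma pos_root_iff_coord:
  assumes "is_root v" "coord v $ j > 0"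
  shows "pos_root v"
  using root_dichotomy[OF assms(1)] assms(2) by (auto simp: pos_root_def not_le[symmetric])

text \<open>If \<open>v = t *\<^sub>R \<alpha> k\<close>, comparing norms gives
  \<open>d k * t / d i * t = 1\<close>, a product of two integers. The dual integrality condition is
  what excludes \<open>t = 2\<close> when \<open>d i = 4 * d k\<close>.\<close>

lemma pos_root_multiple_simple_root:
  assumes "pos_root v" "\<And>j. j \<noteq> k \<Longrightarrow> coord v $ j = 0"
  shows "v = \<alpha> k"
proof -
  define t where "t = coord v $ k"
  have "coord v = coord (t *\<^sub>R \<alpha> k)"
    using assms(2) by (auto simp: vec_eq_iff axis_def t_def)
  then have v: "v = t *\<^sub>R \<alpha> k"
    by (simp only: coord_eq_iff)
  obtain i where i: "form v v = 2 * d i" and "t \<in> \<int>" "d k * t / d i \<in> \<int>"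
    using assms(1) unfolding pos_root_def is_root_def t_def by blast
  have "t \<ge> 0"
    using assms(1) unfolding pos_root_def t_def by blast
  have "d i = d k * t * t"
    using i by (simp add: v form_scaleR_left form_scaleR_right form_simple_root_right
        simple_root_diag mult_ac)
  then have "t \<noteq> 0" and "d k * t / d i * t = 1"
    using d_pos[of i] by auto
  moreover obtain a b where "t = real_of_int a" "d k * t / d i = real_of_int b"
    using \<open>t \<in> \<int>\<close> \<open>d k * t / d i \<in> \<int>\<close> by (metis Ints_cases)
  ultimately have "real_of_int (b * a) = 1"
    by (simp only: of_int_mult)
  then have "b * a = 1"
    by linarith
  then have "t = 1"
    using \<open>t \<ge> 0\<close> \<open>t = real_of_int a\<close> by (auto simp: zmult_eq_1_iff)
  then show ?thesis using v by simp
qed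

text \<open>\<open>s k\<close> alters only the coordinate at \<open>k\<close>. Any other positive
  coordinate of \<open>v\<close> would survive and make \<open>s k v\<close> positive.\<close>

lemma pos_root_simple_reflection:
  assumes "pos_root v" "\<not> pos_root (s k v)"
  shows "v = \<alpha> k"
proof (rule pos_root_multiple_simple_root[OF assms(1)])
  fix j assume "j \<noteq> k"
  then have "coord (s k v) $ j = coord v $ j"
    by (simp add: coord_simple_reflection)
  moreover have "is_root (s k v)"
    using assms(1) is_root_simple_reflection unfolding pos_root_def by blast
  ultimately have "coord v $ j \<le> 0"
    using pos_root_iff_coord[of "s k v" j] assms(2) by force
  then show "coord v $ j = 0"
    using assms(1) by (simp add: pos_root_def order_antisym)
qed

section \<open>Finiteness of the root set and of the Weyl group\<close>

text \<open>The quadratic form attains a positive minimum on the compact unit sphere; homogeneity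
  carries the bound to all vectors.\<close>

lemma coercive: "\<exists>e>0. \<forall>v. form v v \<ge> e * (norm (coord v))\<^sup>2"
proof -
  let ?Q = "\<lambda>x :: real ^ 'i. \<Sum>i\<in>UNIV. \<Sum>j\<in>UNIV. d i * real_of_int (A $ i $ j) * x $ i * x $ j"
  let ?S = "sphere (0 :: real ^ 'i) 1"
  have "?S \<noteq> {}"
    using norm_axis_1 by (metis dist_0_norm emptyE mem_sphere)
  moreover have "continuous_on ?S ?Q"
    by (intro continuous_intros)
  ultimately obtain x0 where x0: "x0 \<in> ?S" "\<And>x. x \<in> ?S \<Longrightarrow> ?Q x0 \<le> ?Q x"
    using continuous_attains_inf[OF compact_sphere, of 0 1 ?Q] by blast
  have "?Q x0 > 0"
    using x0(1) by (intro pos_def) auto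
  moreover have "form v v \<ge> ?Q x0 * (norm (coord v))\<^sup>2" for v
  proof (cases "v = 0")
    case False
    define r where "r = norm (coord v)"
    have "r > 0"
      using False unfolding r_def by (metis coord_eq_iff coord_zero zero_less_norm_iff)
    have "?Q x0 \<le> ?Q ((1 / r) *\<^sub>R coord v)"
      using \<open>r > 0\<close> by (intro x0(2)) (simp add: r_def)
    also have "\<dots> = form v v / r\<^sup>2"
      unfolding form_eq sum_divide_distrib
      by (intro sum.cong refl) (simp add: power2_eq_square)
    finally show ?thesis
      using \<open>r > 0\<close> by (simp add: r_def field_simps)
  qed (simp add: form_def)
  ultimately show ?thesis by blast
qed

text \<open>Root norms take the finitely many values \<open>2 * d i\<close>, so coercivity bounds
  the integral coordinates.\<close>

lemma finite_roots: "finite {v. is_root v}"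
proof -
  obtain e where e: "e > 0" "\<And>v. form v v \<ge> e * (norm (coord v))\<^sup>2"
    using coercive by blast
  define C where "C = sqrt (2 * Max (range d) / e)"
  have C: "norm (coord v) \<le> C" if "is_root v" for v
  proof -
    obtain i where "form v v = 2 * d i"
      using \<open>is_root v\<close> unfolding is_root_def by blast
    moreover have "d i \<le> Max (range d)"
      by simp
    ultimately have "e * (norm (coord v))\<^sup>2 \<le> 2 * Max (range d)"
      using e(2)[of v] by linarith
    then show ?thesis
      unfolding C_def using e(1) by (intro real_le_rsqrt) (simp add: field_simps)
  qed
  then have "{v. is_root v}
      \<subseteq> root_combination ` {x. (\<forall>j. x $ j \<in> \<int>) \<and> norm x \<le> C}"
    using C by (auto simp: is_root_def intro!: image_eqI[of _ _ "coord _"])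
  then show ?thesis
    using finite_integral_vectors finite_subset by blast
qed

lemma linear_eq_on_simple_roots:
  assumes "linear f" "linear g" "\<And>i. f (\<alpha> i) = g (\<alpha> i)"
  shows "f = g"
proof
  fix v
  have "f (root_combination x) = g (root_combination x)" for x
    unfolding root_combination_def
    by (simp add: linear_sum[OF assms(1)] linear_sum[OF assms(2)] linear_cmul[OF assms(1)]
        linear_cmul[OF assms(2)] assms(3))
  then show "f v = g v"
    by (metis root_combination_coord)
qed

text \<open>An element is determined by the images of the simple roots, which lie in the finite root
  set.\<close>

lemma finite_weyl_group: "finite (range prd)"
proof (rule finite_imageD)
  let ?F = "\<lambda>w i. w (\<alpha> i)"
  have "?F ` range prd \<subseteq> PiE UNIV (\<lambda>_. {v. is_root v})"
    using is_root_reflection_product[OF is_root_simple_root] by auto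
  then show "finite (?F ` range prd)"
    by (rule finite_subset) (intro finite_PiE finite_roots finite)
  show "inj_on ?F (range prd)"
  proof (rule inj_onI)
    fix f g assume "f \<in> range prd" "g \<in> range prd" and eq: "?F f = ?F g"
    then have "linear f" "linear g"
      using linear_reflection_product by blast+
    then show "f = g"
      using fun_cong[OF eq] by (rule linear_eq_on_simple_roots)
  qed
qed

section \<open>Exchange and dominant weights in an orbit\<close>

lemma prd_rev [simp]: "prd (rev us) (prd us v) = v" "prd us (prd (rev us) v) = v"
  by (induction us arbitrary: v) simp_all

lemma prd_minus: "prd us (- v) = - prd us v"
  by (rule linear_neg[OF linear_reflection_product])

text \<open>Invariance of the form gives first \<open>d i = d k\<close> and then
  \<open>v $ i = prd us v $ k\<close>.\<close>

lemma reflection_conjugate: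
  assumes "prd us (\<alpha> i) = \<alpha> k"
  shows "prd us (s i v) = s k (prd us v)"
proof -
  have "2 * d i = form (\<alpha> i) (\<alpha> i)" "2 * d k = form (\<alpha> k) (\<alpha> k)"
    by (simp_all add: form_simple_root_right simple_root_diag)
  then have "d i = d k"
    using form_reflection_product[of us "\<alpha> i" "\<alpha> i"] assms by simp
  moreover have "d i * v $ i = d k * prd us v $ k"
    using form_reflection_product[of us v "\<alpha> i"] assms by (simp add: form_simple_root_right)
  ultimately have "v $ i = prd us v $ k"
    using d_pos[of k] by simp
  then show ?thesis
    by (simp add: simple_reflection_def linear_diff[OF linear_reflection_product]
        linear_cmul[OF linear_reflection_product] assms)
qed

text \<open>As the letters act from the right, \<open>\<alpha> i\<close> turns negative at some
  letter \<open>a\<close>. Just before, it equals \<open>\<alpha> a\<close>, so \<open>s i\<close>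
  moved to the left past the letters after \<open>a\<close> becomes \<open>s a\<close> and cancels
  that letter.\<close>

lemma exchange:
  assumes "pos_root (- prd us (\<alpha> i))"
  shows "\<exists>vs. length vs < length us \<and> prd us \<circ> s i = prd vs"
  using assms
proof (induction us)
  case Nil
  then show ?case using not_pos_root_minus pos_root_simple_root by auto
next
  case (Cons a us)
  show ?case
  proof (cases "pos_root (prd us (\<alpha> i))")
    case True
    moreover have "\<not> pos_root (s a (prd us (\<alpha> i)))"
      using Cons.prems not_pos_root_minus[of "s a (prd us (\<alpha> i))"] by auto
    ultimately have "prd us (\<alpha> i) = \<alpha> a"
      by (rule pos_root_simple_reflection)
    then have "prd (a # us) \<circ> s i = prd us"
      by (auto simp: reflection_conjugate)
    then show ?thesis by (intro exI[of _ us]) (simp only: length_Cons lessI simp_thms)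
  next
    case False
    then have "pos_root (- prd us (\<alpha> i))"
      using root_dichotomy is_root_reflection_product is_root_simple_root by blast
    then obtain vs where vs: "length vs < length us" "prd us \<circ> s i = prd vs"
      using Cons.IH by blast
    have "prd (a # us) \<circ> s i = prd (a # vs)"
      by (simp only: reflection_product_Cons comp_assoc vs(2))
    moreover have "length (a # vs) < length (a # us)"
      using vs(1) by simp
    ultimately show ?thesis by blast
  qed
qed

text \<open>If a shortest word ended in a letter \<open>a\<close>, its remaining part would make
  \<open>\<alpha> a\<close> negative, and exchange would shorten it.\<close>

lemma reflection_product_eq_id:
  assumes "\<And>i. pos_root (prd us (\<alpha> i))"
  shows "prd us = id"
proof -
  obtain ws where ws: "prd us = prd ws" "length ws = weyl_length A (prd us)"
    using weyl_length_word by blast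
  show ?thesis
  proof (cases ws rule: rev_cases)
    case (snoc vs a)
    have "prd vs (\<alpha> a) = - prd us (\<alpha> a)"
      by (simp add: ws(1) snoc reflection_simple_root_self prd_minus)
    then have "pos_root (- prd vs (\<alpha> a))"
      using assms by simp
    then obtain zs where "length zs < length vs" "prd vs \<circ> s a = prd zs"
      using exchange by blast
    then have "weyl_length A (prd us) < length vs"
      using weyl_length_le[of A zs] ws(1) snoc by simp
    then show ?thesis using ws(2) snoc by simp
  qed (use ws in simp)
qed

text \<open>Induction on the word. If it makes some \<open>\<alpha> k\<close> negative, dominance on
  both sides forces \<open>v $ k = 0\<close>; then \<open>s k\<close> fixes \<open>v\<close>, and
  exchange supplies a shorter word with the same value at \<open>v\<close>.\<close>

lemma dominant_unique:
  assumes "\<And>k. v $ k \<ge> 0" "\<And>k. prd us v $ k \<ge> 0"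
  shows "prd us v = v"
  using assms(2)
proof (induction us rule: measure_induct_rule[of length])
  case (less us)
  show ?case
  proof (cases "\<forall>k. pos_root (prd us (\<alpha> k))")
    case True
    then have "prd us = id" by (intro reflection_product_eq_id) blast
    then show ?thesis by simp
  next
    case False
    then obtain k where k: "pos_root (- prd us (\<alpha> k))"
      using root_dichotomy is_root_reflection_product is_root_simple_root by blast
    \<comment> \<open>A dominant weight pairs nonnegatively with a positive root.\<close>
    then have "0 \<le> form (prd us v) (- prd us (\<alpha> k))"
      unfolding form_def using less.prems d_pos
      by (auto simp: pos_root_def less_imp_le intro!: sum_nonneg mult_nonneg_nonneg
          simp del: coord_minus)
    also have "\<dots> = - (d k * v $ k)"
      by (simp add: form_minus_right form_reflection_product form_simple_root_right)
    finally have "d k * v $ k \<le> 0" by simp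
    then have "v $ k = 0"
      using assms(1)[of k] d_pos[of k] by (simp add: mult_le_0_iff)
    then have "s k v = v"
      by (simp add: simple_reflection_def)
    obtain vs where vs: "length vs < length us" "prd us \<circ> s k = prd vs"
      using exchange[OF k] by blast
    have "prd vs v = prd us v"
      using fun_cong[OF vs(2), of v] \<open>s k v = v\<close> by simp
    then show ?thesis
      using less.IH[OF vs(1)] less.prems by simp
  qed
qed

section \<open>The longest element and the star involution\<close>

text \<open>A property that singles out the longest element without mentioning
  \<open>weyl_length\<close>.\<close>

definition negates_pos_roots :: "(real ^ 'i \<Rightarrow> real ^ 'i) \<Rightarrow> bool" where
  "negates_pos_roots w \<longleftrightarrow> (\<forall>v. pos_root v \<longrightarrow> pos_root (- w v))"

text \<open>Positive roots are nonnegative combinations of simple roots, so linearity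
  suffices.\<close>

lemma negates_pos_rootsI:
  assumes "\<And>i. pos_root (- prd us (\<alpha> i))"
  shows "negates_pos_roots (prd us)"
  unfolding negates_pos_roots_def
proof (intro allI impI)
  fix v assume v: "pos_root v"
  have "- prd us v = - prd us (root_combination (coord v))"
    by simp
  also have "\<dots> = (\<Sum>j\<in>UNIV. coord v $ j *\<^sub>R (- prd us (\<alpha> j)))"
    unfolding root_combination_def
    by (simp add: linear_sum[OF linear_reflection_product] linear_cmul[OF linear_reflection_product]
        sum_negf)
  finally have eq: "coord (- prd us v) $ k
      = (\<Sum>j\<in>UNIV. coord v $ j * coord (- prd us (\<alpha> j)) $ k)" for k
    by (simp only: linear_sum[OF linear_coord] coord_scaleR sum_component vector_scaleR_component
        real_scaleR_def)
  have "0 \<le> coord (- prd us v) $ k" for k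
    unfolding eq using v assms
    by (intro sum_nonneg mult_nonneg_nonneg) (simp_all add: pos_root_def del: coord_minus)
  moreover have "is_root (- prd us v)"
    using v is_root_minus is_root_reflection_product unfolding pos_root_def by blast
  ultimately show "pos_root (- prd us v)"
    unfolding pos_root_def by blast
qed

lemma negates_pos_roots_rev:
  assumes "negates_pos_roots (prd us)"
  shows "negates_pos_roots (prd (rev us))"
  unfolding negates_pos_roots_def
proof (intro allI impI)
  fix v assume v: "pos_root v"
  have "\<not> pos_root (prd (rev us) v)"
    using assms v not_pos_root_minus unfolding negates_pos_roots_def by fastforce
  then show "pos_root (- prd (rev us) v)"
    using root_dichotomy is_root_reflection_product v unfolding pos_root_def by blast
qed

text \<open>The inverse of one element composed with the other negates twice, so it keeps the simple
  roots positive and is the identity.\<close>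

lemma negates_pos_roots_unique:
  assumes "negates_pos_roots (prd us)" "negates_pos_roots (prd vs)"
  shows "prd us = prd vs"
proof -
  have "pos_root (prd (rev us @ vs) (\<alpha> i))" for i
  proof -
    have "pos_root (- prd (rev us) (- prd vs (\<alpha> i)))"
      using assms negates_pos_roots_rev pos_root_simple_root unfolding negates_pos_roots_def by blast
    then show ?thesis by (simp add: prd_minus)
  qed
  then have *: "prd (rev us @ vs) = id"
    by (rule reflection_product_eq_id)
  have "prd us v = prd vs v" for v
    using arg_cong[OF fun_cong[OF *, of v], of "prd us"] by simp
  then show ?thesis by blast
qed

text \<open>Were \<open>prd us (\<alpha> i)\<close> positive, exchange in a shortest word for
  \<open>prd (us @ [i])\<close> would give a strictly shorter word for \<open>prd us\<close>,
  against maximality.\<close>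

lemma longest_negates_pos_roots:
  assumes "\<And>vs. weyl_length A (prd vs) \<le> weyl_length A (prd us)"
  shows "negates_pos_roots (prd us)"
proof (rule negates_pos_rootsI)
  fix i
  show "pos_root (- prd us (\<alpha> i))"
  proof (rule ccontr)
    assume "\<not> ?thesis"
    then have pos: "pos_root (prd us (\<alpha> i))"
      using root_dichotomy is_root_reflection_product is_root_simple_root by blast
    obtain vs where vs: "prd (us @ [i]) = prd vs" "length vs = weyl_length A (prd (us @ [i]))"
      using weyl_length_word by blast
    have "prd vs (\<alpha> i) = - prd us (\<alpha> i)"
      using fun_cong[OF vs(1), of "\<alpha> i"] by (simp add: reflection_simple_root_self prd_minus)
    then obtain zs where zs: "length zs < length vs" "prd vs \<circ> s i = prd zs"
      using exchange[of vs i] pos by auto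
    have "prd zs = prd us"
      unfolding zs(2)[symmetric] vs(1)[symmetric] by (auto simp: fun_eq_iff)
    then show False
      using weyl_length_le[of A zs] zs(1) vs(2) assms[of "us @ [i]"] by simp
  qed
qed

text \<open>Justifies the definite description: finiteness of the group gives existence,
  \<open>negates_pos_roots_unique\<close> uniqueness.\<close>

lemma longest_element_word:
  obtains us where "longest_element A = prd us" "negates_pos_roots (prd us)"
proof -
  let ?L = "\<lambda>w. w \<in> weyl_group A \<and> (\<forall>v\<in>weyl_group A. weyl_length A v \<le> weyl_length A w)"
  have W: "weyl_group A = range prd"
    by (rule weyl_group_eq_range[OF cartan])
  have "Max (weyl_length A ` range prd) \<in> weyl_length A ` range prd"
    using finite_weyl_group by (intro Max_in) auto
  then obtain us where us: "weyl_length A (prd us) = Max (weyl_length A ` range prd)"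
    by force
  then have max: "weyl_length A (prd vs) \<le> weyl_length A (prd us)" for vs
    using finite_weyl_group by simp
  have "longest_element A = prd us"
    unfolding longest_element_def
  proof (rule the_equality)
    show "?L (prd us)"
      using max by (auto simp: W)
    show "w = prd us" if w: "?L w" for w
    proof -
      obtain ws where ws: "w = prd ws"
        using conjunct1[OF w] unfolding W by (rule rangeE)
      have "weyl_length A (prd vs) \<le> weyl_length A (prd ws)" for vs
        using conjunct2[OF w] unfolding W ws by (rule bspec) (rule rangeI)
      then show ?thesis
        unfolding ws by (intro negates_pos_roots_unique longest_negates_pos_roots max)
    qed
  qed
  then show thesis
    using that longest_negates_pos_roots[OF max] by blast
qed

lemma star_involutionI:
  assumes "prd us (fundamental_weight i) = - fundamental_weight j"
  shows "star_involution A i = j"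
proof -
  obtain ws where ws: "longest_element A = prd ws" "negates_pos_roots (prd ws)"
    using longest_element_word by blast
  let ?\<omega> = "fundamental_weight :: 'i \<Rightarrow> _" and ?v = "- prd ws (fundamental_weight i)"
  \<comment> \<open>Up to the factor \<open>d k\<close>, this coordinate is the pairing of a
    fundamental weight with the positive root \<open>- prd (rev ws) (\<alpha> k)\<close>.\<close>
  have "?v $ k \<ge> 0" for k
  proof -
    have "pos_root (- prd (rev ws) (\<alpha> k))"
      using negates_pos_roots_rev[OF ws(2)] pos_root_simple_root
      unfolding negates_pos_roots_def by blast
    then have "0 \<le> form (?\<omega> i) (- prd (rev ws) (\<alpha> k))"
      unfolding form_def using d_pos
      by (auto simp: pos_root_def less_imp_le fundamental_weight_def axis_def
          intro!: sum_nonneg mult_nonneg_nonneg simp del: coord_minus)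
    also have "\<dots> = form (prd ws (?\<omega> i)) (prd ws (- prd (rev ws) (\<alpha> k)))"
      by (simp only: form_reflection_product)
    also have "\<dots> = d k * ?v $ k"
      by (simp add: prd_minus form_minus_right form_simple_root_right)
    finally show ?thesis
      using d_pos[of k] by (simp only: zero_le_mult_iff) linarith
  qed
  moreover have eq: "prd (us @ rev ws) ?v = ?\<omega> j"
    by (simp add: prd_minus assms)
  moreover have "?\<omega> j $ k \<ge> 0" for k
    by (simp add: fundamental_weight_def axis_def)
  ultimately have "prd (us @ rev ws) ?v = ?v"
    by (intro dominant_unique) (simp only: eq)+
  then have longest: "?\<omega> j = - longest_element A (?\<omega> i)"
    using eq ws(1) by simp
  show ?thesis
    unfolding star_involution_def longest[symmetric]
    by (rule the_equality) (simp_all add: fundamental_weight_def axis_eq_axis)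
qed

section \<open>Coxeter elements and the descending chain\<close>

lemma coord_reflection_product:
  "j \<notin> set us \<Longrightarrow> coord (prd us v) $ j = coord v $ j"
  by (induction us) (auto simp: coord_simple_reflection)

text \<open>With distinct letters, the coordinate at the first letter \<open>a\<close> is changed by
  \<open>s a\<close> alone. For a fixed \<open>v\<close> that change is zero, so the remaining word
  fixes \<open>v\<close> too. With all letters present, this is injectivity of
  \<open>1 - c\<close>.\<close>

lemma reflection_product_fixed:
  assumes "distinct us" "prd us v = v" "j \<in> set us"
  shows "v $ j = 0"
  using assms
proof (induction us)
  case (Cons a us)
  have "coord (prd us v) $ a - prd us v $ a = coord v $ a"
    using coord_simple_reflection[of a "prd us v" a] Cons.prems(2) by simp
  moreover have "coord (prd us v) $ a = coord v $ a"
    using Cons.prems(1) by (intro coord_reflection_product) simp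
  ultimately have "prd us v $ a = 0"
    by simp
  moreover from this have "prd us v = v"
    using Cons.prems(2) by (simp add: simple_reflection_def)
  ultimately show ?case
    using Cons by auto
qed simp

lemma pos_root_becomes_negative:
  assumes "pos_root v" "\<not> pos_root (prd us v)"
  obtains xs i ys where "us = xs @ i # ys" "prd ys v = \<alpha> i"
  using assms(2)
proof (induction us arbitrary: thesis)
  case (Cons a us)
  show ?case
  proof (cases "pos_root (prd us v)")
    case True
    then have "prd us v = \<alpha> a"
      using pos_root_simple_reflection Cons.prems(2) by simp
    then show ?thesis
      using Cons.prems(1)[of "[]" a us] by simp
  next
    case False
    then obtain xs i ys where "us = xs @ i # ys" "prd ys v = \<alpha> i"
      using Cons.IH by blast
    then show ?thesis
      using Cons.prems(1)[of "a # xs" i ys] by simp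
  qed
qed (use assms(1) in simp)

text \<open>Only the letter \<open>j\<close> moves this weight, subtracting
  \<open>\<alpha> j\<close>, on which \<open>xs\<close> then acts.\<close>

lemma fundamental_weight_diff:
  assumes "distinct us" "us = xs @ j # ys"
  shows "fundamental_weight j - prd us (fundamental_weight j) = prd xs (\<alpha> j)"
  using assms
  by (simp add: reflection_product_fundamental_weight simple_reflection_fundamental_weight
      linear_diff[OF linear_reflection_product])

lemma pos_root_fundamental_weight_diff:
  assumes "distinct us" "j \<in> set us"
  shows "pos_root (fundamental_weight j - prd us (fundamental_weight j))"
proof -
  obtain xs ys where us: "us = xs @ j # ys"
    using assms(2) by (meson split_list)
  \<comment> \<open>The letter \<open>j\<close> does not occur in \<open>xs\<close>, so this
    coefficient is never touched.\<close>
  have "coord (prd xs (\<alpha> j)) $ j = 1"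
    using assms(1) us by (simp add: coord_reflection_product)
  then have "pos_root (prd xs (\<alpha> j))"
    using is_root_reflection_product[OF is_root_simple_root]
    by (intro pos_root_iff_coord[of _ j]) auto
  then show ?thesis
    using fundamental_weight_diff[OF assms(1) us] by simp
qed

lemma weight_gtI:
  assumes "pos_root (u - v)"
  shows "weight_gt A u v"
proof -
  define n where "n j = nat \<lfloor>coord (u - v) $ j\<rfloor>" for j
  have "coord (u - v) $ j = real (n j)" for j
    using assms unfolding pos_root_def is_root_def n_def
    by (metis Ints_cases floor_of_int of_int_0_le_iff of_nat_nat)
  then have "root_combination (coord (u - v)) = (\<Sum>j\<in>UNIV. real (n j) *\<^sub>R \<alpha> j)"
    by (simp only: root_combination_def)
  then have "u - v = (\<Sum>j\<in>UNIV. real (n j) *\<^sub>R \<alpha> j)"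
    by (simp only: root_combination_coord)
  moreover have "u \<noteq> v"
    using assms is_root_nonzero[of "u - v"] unfolding pos_root_def by auto
  ultimately show ?thesis
    unfolding weight_gt_def weight_ge_def by blast
qed

lemma funpow_reflection_product: "\<exists>vs. prd us ^^ k = prd vs"
proof (induction k)
  case 0
  show ?case by (rule exI[of _ "[]"]) simp
next
  case (Suc k)
  then obtain vs where "prd us ^^ k = prd vs" by blast
  then show ?case by (intro exI[of _ "us @ vs"]) simp
qed

text \<open>Two powers agree because the group is finite. Along the chain the coordinates never
  increase, so they are constant between these powers, and a difference that should be a root
  vanishes.\<close>

lemma not_all_pos_root:
  assumes "\<And>k. pos_root ((prd us ^^ k) v - (prd us ^^ Suc k) v)"
  shows False
proof -
  have "range (\<lambda>k. prd us ^^ k) \<subseteq> range prd"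
    using funpow_reflection_product[of _ us] by (simp add: image_subset_iff image_iff)
  then have "finite (range (\<lambda>k. prd us ^^ k))"
    using finite_weyl_group finite_subset by blast
  then have "\<not> inj (\<lambda>k. prd us ^^ k)"
    using finite_imageD by auto
  then obtain m n where "m < n" and eq: "prd us ^^ m = prd us ^^ n"
    unfolding inj_def by (metis linorder_neqE_nat)
  define f where "f k = coord ((prd us ^^ k) v)" for k
  have mono: "f (Suc k) $ j \<le> f k $ j" for k j
    using assms[of k] unfolding pos_root_def f_def by simp
  have "f n $ j \<le> f (Suc m) $ j" for j
    by (rule lift_Suc_antimono_le[of "\<lambda>k. f k $ j"]) (use \<open>m < n\<close> mono in simp_all)
  then have "f m $ j = f (Suc m) $ j" for j
    using mono[where k = m and j = j] eq by (metis f_def order_antisym)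
  then have "f m = f (Suc m)"
    by (simp add: vec_eq_iff)
  then have "(prd us ^^ m) v = (prd us ^^ Suc m) v"
    unfolding f_def coord_eq_iff .
  then show False
    using assms[of m] is_root_nonzero unfolding pos_root_def by force
qed

lemma coxeter_chain:
  assumes us: "distinct us" "set us = UNIV"
  defines "c \<equiv> prd us"
  obtains h j where "h > 0"
    and "\<And>k. k < h \<Longrightarrow>
      pos_root ((c ^^ k) (fundamental_weight i) - (c ^^ Suc k) (fundamental_weight i))"
    and "(c ^^ h) (fundamental_weight i) = - fundamental_weight j"
proof -
  let ?\<omega> = "fundamental_weight :: 'i \<Rightarrow> _"
  have lin: "linear c"
    unfolding c_def by (rule linear_reflection_product)
  define \<delta> where "\<delta> k = (c ^^ k) (?\<omega> i) - (c ^^ Suc k) (?\<omega> i)" for k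
  have \<delta>_Suc: "\<delta> (Suc k) = c (\<delta> k)" for k
    by (simp add: \<delta>_def linear_diff[OF lin])
  have "\<exists>k. \<not> pos_root (\<delta> k)"
    using not_all_pos_root unfolding \<delta>_def c_def by blast
  define h where "h = (LEAST k. \<not> pos_root (\<delta> k))"
  have h: "\<not> pos_root (\<delta> h)" "\<And>k. k < h \<Longrightarrow> pos_root (\<delta> k)"
    using LeastI_ex[OF \<open>\<exists>k. \<not> pos_root (\<delta> k)\<close>] not_less_Least unfolding h_def by blast+
  have "pos_root (\<delta> 0)"
    using pos_root_fundamental_weight_diff[of us i] us by (simp add: \<delta>_def c_def)
  then have "h \<noteq> 0"
    using h(1) by metis
  then obtain g where g: "h = Suc g"
    by (cases h) auto
  have "pos_root (\<delta> g)" "\<not> pos_root (prd us (\<delta> g))"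
    using h g \<delta>_Suc[of g] by (auto simp: c_def)
  then obtain xs j ys where split: "us = xs @ j # ys" and j: "prd ys (\<delta> g) = \<alpha> j"
    by (rule pos_root_becomes_negative)
  \<comment> \<open>The letter \<open>j\<close> flips \<open>\<alpha> j\<close>. The prefix
    \<open>xs\<close> then yields the root of \<open>fundamental_weight_diff\<close> up to
    sign.\<close>
  have "\<delta> h = - prd xs (\<alpha> j)"
    unfolding g \<delta>_Suc by (simp add: c_def split j reflection_simple_root_self prd_minus)
  then have "\<delta> h = - (?\<omega> j - c (?\<omega> j))"
    using fundamental_weight_diff[OF us(1) split] by (simp only: c_def)
  \<comment> \<open>Rearranged, the equality of differences says that \<open>c\<close> fixes this
    sum, which must therefore be zero.\<close>
  then have "c ((c ^^ h) (?\<omega> i) + ?\<omega> j) = (c ^^ h) (?\<omega> i) + ?\<omega> j"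
    unfolding linear_add[OF lin] by (simp add: \<delta>_def algebra_simps)
  then have "((c ^^ h) (?\<omega> i) + ?\<omega> j) $ k = 0" for k
    using us unfolding c_def by (intro reflection_product_fixed[of us]) auto
  then have "(c ^^ h) (?\<omega> i) + ?\<omega> j = 0"
    by (simp add: vec_eq_iff)
  then have "(c ^^ h) (?\<omega> i) = - ?\<omega> j"
    by (simp add: eq_neg_iff_add_eq_0)
  then show thesis
    using that \<open>h \<noteq> 0\<close> h(2) unfolding \<delta>_def by blast
qed

end

theorem proposition1p3:
  fixes A :: "int ^ 'i::finite ^ 'i"
    and c :: "real ^ 'i \<Rightarrow> real ^ 'i"
  assumes "finite_type_cartan_matrix A"
    and "coxeter_element A c"
  shows "\<forall>i. \<exists>h::nat. h > 0 \<and>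
           (\<forall>k<h. weight_gt A ((c ^^ k) (fundamental_weight i)) ((c ^^ Suc k) (fundamental_weight i))) \<and>
           (c ^^ h) (fundamental_weight i) = - fundamental_weight (star_involution A i)"
proof
  fix i :: 'i
  obtain d :: "'i \<Rightarrow> real" where "symmetrized_cartan_matrix A d"
    using assms(1) unfolding finite_type_cartan_matrix_def symmetrized_cartan_matrix_def by blast
  then interpret symmetrized_cartan_matrix A d .
  obtain us where us: "distinct us" "set us = UNIV" and c: "c = reflection_product A us"
    using assms(2) unfolding coxeter_element_def by blast
  obtain h j where h: "h > 0"
    and chain: "\<And>k. k < h \<Longrightarrow>
      pos_root ((c ^^ k) (fundamental_weight i) - (c ^^ Suc k) (fundamental_weight i))"
    and final: "(c ^^ h) (fundamental_weight i) = - fundamental_weight j"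
    using coxeter_chain[OF us, of i] unfolding c by blast
  \<comment> \<open>The power is itself a word, so \<open>star_involutionI\<close> identifies
    \<open>j\<close>.\<close>
  obtain vs where "c ^^ h = reflection_product A vs"
    using funpow_reflection_product[of h us] unfolding c by blast
  then have "star_involution A i = j"
    using final by (intro star_involutionI) simp
  then show "\<exists>h::nat. h > 0 \<and>
      (\<forall>k<h. weight_gt A ((c ^^ k) (fundamental_weight i)) ((c ^^ Suc k) (fundamental_weight i))) \<and>
      (c ^^ h) (fundamental_weight i) = - fundamental_weight (star_involution A i)"
    using h weight_gtI[OF chain] final by blast
qed

end
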